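(* Let $\Delta$ be endowed with a $\sigma$-algebra and a probability measure $\mathbb{P}$, fix an iteration count $k$, and let $\phi(z^k(x),x)\ge 0$, $x\in\Delta$, be the performance metric after $k$ iterations. Assume non-accumulation: for every $e\ge 0$, $\mathbb{P}\{x\in\Delta:\phi(z^k(x),x)=e\}=0$. Let $\rho>0$ and let $x_1,\dots,x_N$ be $N$ i.i.d. samples from $\Delta$ drawn according to $\mathbb{P}$. Consider the relaxed scenario optimization problem $$\min_{e\ge 0,\ \xi_{N,i}\ge 0,\ i=1,\dots,N}\ \ e+\rho\sum_{i=1}^N\xi_{N,i}\qquad\text{subject to}\quad e+\xi_{N,i}\ge\phi(z^k(x_i),x_i),\quad i=1,\dots,N.$$ Let $e_N^*$, also denoted $e_N^k(\rho)$, be its optimal solution in $e$ (assumed unique; otherwise a particular solution is singled out by a tie-break rule), let $\xi_{N,i}^*$ be the corresponding optimal relaxation variables, let $q_N^*:=|\{i:\xi_{N,i}^*>0\}|$ be the number of constraints whose relaxation variables are positive, and let $s_N^*:=1+q_N^*$. For $e\ge 0$ let $V(e)=\mathbb{P}\{x\in\Delta:\phi(z^k(x),x)>e\}$. Fix $\beta\in(0,1)$. Then $$\mathbb{P}^N\bigl\{\{x_i\}_{i=1}^N:\ \underline{\epsilon}(s_N^* )\le V(e_N^k(\rho))\le\overline{\epsilon}(s_N^* )\bigr\}\ge 1-\beta,$$ where $\underline{\epsilon}(q):=\max\{0,1-\bar t(q)\}$ and $\overline{\epsilon}(q):=1-\underline t(q)$ for $q=0,1,\dots,N$, and $\underline t(q)$,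 $\bar t(q)$ are defined as follows. For $q=0,1,\dots,N-1$, $\underline t(q)\le\bar t(q)$ are the two solutions in $[0,+\infty)$ of $$\binom{N}{q}t^{N-q}-\frac{\beta}{2N}\sum_{i=q}^{N-1}\binom{i}{q}t^{i-q}-\frac{\beta}{6N}\sum_{i=N+1}^{4N}\binom{i}{q}t^{i-q}=0;$$ for $q=N$, $\underline t(N):=0$ and $\bar t(N)$ is the unique solution in $[0,+\infty)$ of $$1-\frac{\beta}{6N}\sum_{i=N+1}^{4N}\binom{i}{N}t^{i-N}=0.$$
   Context: Setting. Consider a parametric optimization problem: minimize $f(z,x)$ over $z\in\mathbb{R}^n$ subject to $f_i(z,x)=0$ ($i=1,\dots,I$) and $g_j(z,x)\ge 0$ ($j=1,\dots,J$), with parameter $x\in\Delta\subset\mathbb{R}^d$, where $\Delta$ is the set of parameters for which the problem has at least one feasible solution. Its (potentially local) optimal solution is denoted $z^*(x)$ and is assumed unique for any given parameter; otherwise a particular solution is singled out by a tie-break rule. An iterative algorithm produces iterates $z^k(x)$, where $k$ is the iteration count, and the solver is assumed to converge, within a user-defined tolerance, to a point $z^*(x)$ in the nonempty set $\mathcal{Z}^*_{\rm local}(x)$ of local optimizers. The performance metric after $k$ iterations is $\phi(z^k(x),x)=\mathrm{dist}(z^k(x),z^*(x))$, where $\mathrm{dist}:\mathbb{R}^n\times\mathbb{R}^n\to\mathbb{R}_{\ge 0}$ is any continuous-valued (as opposed to discrete-valued) distance measure; if this metric differs from the convergence metric used by the solver, $\mathcal{Z}^*_{\rm local}(x)$ is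 assumed to consist of a single point. $\mathbb{P}^N$ denotes the $N$-fold product probability on $\Delta^N$. $V(e)$ is the risk: the probability that the performance metric of a new parameter instance exceeds $e$. The weight $\rho$ balances minimizing the performance bound $e$ against constraint violation. For $q\le N-1$ the stated polynomial equation has exactly two solutions in $[0,+\infty)$, and the one for $q=N$ has exactly one.
   Formalization: When the optimal e is not unique, the tie-break rule is fixed as always the smallest or always the largest optimal e (the bound can fail for other rules); where s_N^* = N+1, for which the epsilons are undefined, they keep their values at N. *)

theory Defs
  imports "HOL-Probability.Probability"
begin

definition performance :: "('z \<Rightarrow> 'x \<Rightarrow> real) \<Rightarrow> (nat \<Rightarrow> 'x \<Rightarrow> 'z) \<Rightarrow> nat \<Rightarrow> 'x \<Rightarrow> real" where
  "performance \<phi> z k x = \<phi> (z k x) x"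

definition risk :: "'x measure \<Rightarrow> ('x \<Rightarrow> real) \<Rightarrow> real \<Rightarrow> real" where
  "risk M g e = measure M {x \<in> space M. g x > e}"

text \<open>The relaxed scenario problem for \<open>N\<close> sampled performance values \<open>p 1, \<dots>, p N\<close>.\<close>

definition relaxed_feasible :: "nat \<Rightarrow> (nat \<Rightarrow> real) \<Rightarrow> real \<times> (nat \<Rightarrow> real) \<Rightarrow> bool" where
  "relaxed_feasible N p = (\<lambda>(e, \<xi>). e \<ge> 0 \<and> (\<forall>i\<in>{1..N}. \<xi> i \<ge> 0 \<and> e + \<xi> i \<ge> p i))"

definition relaxed_cost :: "real \<Rightarrow> nat \<Rightarrow> real \<times> (nat \<Rightarrow> real) \<Rightarrow> real" where
  "relaxed_cost \<rho> N = (\<lambda>(e, \<xi>). e + \<rho> * (\<Sum>i=1..N. \<xi> i))"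

definition relaxed_optimal ::
  "real \<Rightarrow> nat \<Rightarrow> (nat \<Rightarrow> real) \<Rightarrow> real \<Rightarrow> (nat \<Rightarrow> real) \<Rightarrow> bool" where
  "relaxed_optimal \<rho> N p e \<xi> \<longleftrightarrow> is_arg_min (relaxed_cost \<rho> N) (relaxed_feasible N p) (e, \<xi>)"

text \<open>
  The two polynomial equations are instances of one: at \<open>q = N\<close> the first sum is empty
  and the leading term equals 1.
\<close>

definition eps_poly :: "nat \<Rightarrow> real \<Rightarrow> nat \<Rightarrow> real \<Rightarrow> real" where
  "eps_poly N \<beta> q t =
     real (N choose q) * t ^ (N - q)
     - \<beta> / (2 * real N) * (\<Sum>i=q..<N. real (i choose q) * t ^ (i - q))
     - \<beta> / (6 * real N) * (\<Sum>i=N+1..4*N. real (i choose q) * t ^ (i - q))"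

text \<open>
  The bounds are tabulated for \<open>q \<le> N\<close> only, but the complexity \<open>1 + q\<^sub>N\<^sup>*\<close> they are evaluated at
  equals \<open>N + 1\<close> when every relaxation variable is positive (for instance when \<open>\<rho> < 1 / N\<close>,
  where the optimal \<open>e\<close> is 0). Beyond \<open>N\<close> the functions keep their value at \<open>N\<close>.
\<close>

definition t_low :: "nat \<Rightarrow> real \<Rightarrow> nat \<Rightarrow> real" where
  "t_low N \<beta> q = (if q < N then Min {t. 0 \<le> t \<and> eps_poly N \<beta> q t = 0} else 0)"

definition t_high :: "nat \<Rightarrow> real \<Rightarrow> nat \<Rightarrow> real" where
  "t_high N \<beta> q =
     (if q < N then Max {t. 0 \<le> t \<and> eps_poly N \<beta> q t = 0}
      else (THE t. 0 \<le> t \<and> eps_poly N \<beta> N t = 0))"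

definition eps_low :: "nat \<Rightarrow> real \<Rightarrow> nat \<Rightarrow> real" where
  "eps_low N \<beta> q = max 0 (1 - t_high N \<beta> q)"

definition eps_high :: "nat \<Rightarrow> real \<Rightarrow> nat \<Rightarrow> real" where
  "eps_high N \<beta> q = 1 - t_low N \<beta> q"

text \<open>
  A selection \<open>sol\<close> of optimal solutions \<open>(e, \<xi>)\<close>, one for each sample in \<open>S\<close>. Where the optimal
  \<open>e\<close> is not unique (possible only if \<open>1 / \<rho>\<close> is an integer), the optimal values of \<open>e\<close> form an
  interval; a tie is broken by always taking its smallest, or always taking its largest, element.
  Where the optimal \<open>e\<close> is unique, neither alternative imposes anything.
\<close>

definition tie_broken_solution ::
  "real \<Rightarrow> nat \<Rightarrow> ('x \<Rightarrow> real) \<Rightarrow> (nat \<Rightarrow> 'x) set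
    \<Rightarrow> ((nat \<Rightarrow> 'x) \<Rightarrow> real \<times> (nat \<Rightarrow> real)) \<Rightarrow> bool" where
  "tie_broken_solution \<rho> N g S sol \<longleftrightarrow>
     (\<forall>x\<in>S. relaxed_optimal \<rho> N (g \<circ> x) (fst (sol x)) (snd (sol x))) \<and>
     ((\<forall>x\<in>S. \<forall>e \<xi>. relaxed_optimal \<rho> N (g \<circ> x) e \<xi> \<longrightarrow> fst (sol x) \<le> e) \<or>
      (\<forall>x\<in>S. \<forall>e \<xi>. relaxed_optimal \<rho> N (g \<circ> x) e \<xi> \<longrightarrow> e \<le> fst (sol x)))"

definition num_relaxed :: "nat \<Rightarrow> (nat \<Rightarrow> real) \<Rightarrow> nat" where
  "num_relaxed N \<xi> = card {i \<in> {1..N}. \<xi> i > 0}"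

end

theory Submission
  imports Defs
begin

text \<open>
  Eliminating the relaxation variables leaves the convex piecewise linear cost
  \<open>e + \<rho> \<Sum>\<^sub>i max 0 (p\<^sub>i - e)\<close>, so the optimal \<open>e\<close> is the \<open>s\<close>-th largest sampled value for a fixed
  \<open>s\<close> depending only on \<open>\<rho>\<close> and the tie-break (and \<open>e = 0\<close>, \<open>V e = 1\<close> if \<open>s > N\<close>). Almost surely
  there are no ties among the samples, hence \<open>1 + q\<^sub>N\<^sup>* = s\<close>.

  Write \<open>t = 1 - V\<close> and \<open>w = s V\<^bsup>s-1\<^esup>\<close>, evaluated at the value of one sample. For every sample size
  \<open>n \<ge> s\<close>, the \<open>s\<close>-th largest of \<open>n\<close> samples has density \<open>w (n choose s) t\<^bsup>n-s\<^esup>\<close> with respect to the law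
  of one sample, so each of these functions has integral at most 1. If \<open>t\<close> lies outside
  \<open>[t_low, t_high]\<close>, the polynomial \<open>eps_poly\<close> is nonpositive, which bounds the density for \<open>n = N\<close> by
  a combination of the densities for \<open>n = s, \<dots>, N - 1\<close> and \<open>n = N + 1, \<dots>, 4N\<close> whose weights add up to at
  most \<open>\<beta>\<close>. Integrating bounds the probability of violating the claim by \<open>\<beta>\<close>.
\<close>

subsection \<open>Solutions of the relaxed problem\<close>

definition reduced_cost :: "real \<Rightarrow> nat \<Rightarrow> (nat \<Rightarrow> real) \<Rightarrow> real \<Rightarrow> real" where
  "reduced_cost \<rho> N p e = e + \<rho> * (\<Sum>i=1..N. max 0 (p i - e))"

text \<open>For fixed \<open>e\<close> the constraints bound \<open>\<xi> i\<close> below by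
  \<open>max 0 (p i - e)\<close>, and as \<rho> > 0 any excess raises the cost. Only indices in
  \<open>{1..N}\<close> are pinned down.\<close>

lemma relaxed_optimal_iff:
  assumes "\<rho> > 0"
  shows "relaxed_optimal \<rho> N p e \<xi> \<longleftrightarrow> e \<ge> 0 \<and> (\<forall>i\<in>{1..N}. \<xi> i = max 0 (p i - e)) \<and>
    (\<forall>c\<ge>0. reduced_cost \<rho> N p e \<le> reduced_cost \<rho> N p c)"
  unfolding reduced_cost_def
proof
  assume L: "relaxed_optimal \<rho> N p e \<xi>"
  have "relaxed_feasible N p (e, \<xi>)"
    using L by (simp add: relaxed_optimal_def is_arg_min_def)
  then have feas: "e \<ge> 0" "\<And>i. i \<in> {1..N} \<Longrightarrow> max 0 (p i - e) \<le> \<xi> i"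
    by (auto simp: relaxed_feasible_def algebra_simps)
  have min: "e + \<rho> * (\<Sum>i=1..N. \<xi> i) \<le> c + \<rho> * (\<Sum>i=1..N. max 0 (p i - c))" if "c \<ge> 0" for c
  proof -
    have "relaxed_feasible N p (c, \<lambda>i. max 0 (p i - c))"
      using that by (auto simp: relaxed_feasible_def)
    then have "\<not> relaxed_cost \<rho> N (c, \<lambda>i. max 0 (p i - c)) < relaxed_cost \<rho> N (e, \<xi>)"
      using L unfolding relaxed_optimal_def is_arg_min_def by blast
    then show ?thesis by (simp add: relaxed_cost_def)
  qed
  have le: "(\<Sum>i=1..N. max 0 (p i - e)) \<le> (\<Sum>i=1..N. \<xi> i)"
    by (intro sum_mono feas)
  \<comment> \<open>Taking \<open>c = e\<close> in \<open>min\<close> and cancelling \<rho> reverses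
    \<open>le\<close>; termwise ordered families with equal sums agree.\<close>
  have ge: "(\<Sum>i=1..N. \<xi> i) \<le> (\<Sum>i=1..N. max 0 (p i - e))"
    using min[OF feas(1)] assms by simp
  have eq: "\<xi> i = max 0 (p i - e)" if "i \<in> {1..N}" for i
    using sum_mono_inv[of "\<lambda>i. max 0 (p i - e)" "{1..N}" \<xi> i] le ge feas(2) that
    by (metis antisym finite_atLeastAtMost)
  have "(\<Sum>i=1..N. max 0 (p i - e)) = (\<Sum>i=1..N. \<xi> i)" using le ge by simp
  then show "e \<ge> 0 \<and> (\<forall>i\<in>{1..N}. \<xi> i = max 0 (p i - e)) \<and>
    (\<forall>c\<ge>0. e + \<rho> * (\<Sum>i=1..N. max 0 (p i - e)) \<le> c + \<rho> * (\<Sum>i=1..N. max 0 (p i - c)))"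
    using feas(1) eq min by metis
next
  assume R: "e \<ge> 0 \<and> (\<forall>i\<in>{1..N}. \<xi> i = max 0 (p i - e)) \<and>
    (\<forall>c\<ge>0. e + \<rho> * (\<Sum>i=1..N. max 0 (p i - e)) \<le> c + \<rho> * (\<Sum>i=1..N. max 0 (p i - c)))"
  have "relaxed_cost \<rho> N (e, \<xi>) \<le> relaxed_cost \<rho> N (c, \<eta>)" if f: "relaxed_feasible N p (c, \<eta>)" for c \<eta>
  proof -
    have "(\<Sum>i=1..N. \<xi> i) = (\<Sum>i=1..N. max 0 (p i - e))" using R by (intro sum.cong) auto
    moreover have "(\<Sum>i=1..N. max 0 (p i - c)) \<le> (\<Sum>i=1..N. \<eta> i)"
      using f by (intro sum_mono) (auto simp: relaxed_feasible_def algebra_simps)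
    moreover have "c \<ge> 0" using f by (auto simp: relaxed_feasible_def)
    ultimately have "\<rho> * (\<Sum>i=1..N. max 0 (p i - c)) \<le> \<rho> * (\<Sum>i=1..N. \<eta> i)"
      and "e + \<rho> * (\<Sum>i=1..N. \<xi> i) \<le> c + \<rho> * (\<Sum>i=1..N. max 0 (p i - c))"
      using R assms by simp_all
    then show ?thesis unfolding relaxed_cost_def prod.case by linarith
  qed
  moreover have "relaxed_feasible N p (e, \<xi>)" using R by (auto simp: relaxed_feasible_def)
  ultimately show "relaxed_optimal \<rho> N p e \<xi>" unfolding relaxed_optimal_def is_arg_min_def by (force simp: not_less)
qed

text \<open>Each \<open>i\<close> with \<open>p i \<ge> c\<close> loses the full
  \<open>c - e\<close> from its positive part, and no term grows. The factor is the left derivative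
  of the convex cost at \<open>c\<close>, an upper bound for the slope between \<open>e\<close> and
  \<open>c\<close>.\<close>

lemma reduced_cost_diff_le:
  assumes "\<rho> > 0" "e \<le> c"
  shows "reduced_cost \<rho> N p c - reduced_cost \<rho> N p e \<le> (1 - \<rho> * card {i\<in>{1..N}. p i \<ge> c}) * (c - e)"
proof -
  have "(c - e) * card {i\<in>{1..N}. p i \<ge> c} = (\<Sum>i=1..N. if p i \<ge> c then c - e else 0)"
    by (simp add: sum.inter_filter[symmetric])
  also have "\<dots> \<le> (\<Sum>i=1..N. max 0 (p i - e) - max 0 (p i - c))"
    using assms by (intro sum_mono) auto
  finally have "\<rho> * ((c - e) * card {i\<in>{1..N}. p i \<ge> c}) \<le>
      \<rho> * ((\<Sum>i=1..N. max 0 (p i - e)) - (\<Sum>i=1..N. max 0 (p i - c)))"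
    using assms by (intro mult_left_mono) (simp_all add: sum_subtractf)
  then show ?thesis by (simp add: reduced_cost_def algebra_simps)
qed

text \<open>Only indices with \<open>p i > e\<close> lose anything, each at most
  \<open>c - e\<close>. The factor is the right derivative at \<open>e\<close>, a lower bound for
  the slope.\<close>

lemma reduced_cost_diff_ge:
  assumes "\<rho> > 0" "e \<le> c"
  shows "reduced_cost \<rho> N p c - reduced_cost \<rho> N p e \<ge> (1 - \<rho> * card {i\<in>{1..N}. p i > e}) * (c - e)"
proof -
  have "(\<Sum>i=1..N. max 0 (p i - e) - max 0 (p i - c)) \<le> (\<Sum>i=1..N. if p i > e then c - e else 0)"
    using assms by (intro sum_mono) auto
  also have "\<dots> = (c - e) * card {i\<in>{1..N}. p i > e}"
    by (simp add: sum.inter_filter[symmetric])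
  finally have "\<rho> * ((\<Sum>i=1..N. max 0 (p i - e)) - (\<Sum>i=1..N. max 0 (p i - c))) \<le>
      \<rho> * ((c - e) * card {i\<in>{1..N}. p i > e})"
    using assms by (intro mult_left_mono) (simp_all add: sum_subtractf)
  then show ?thesis by (simp add: reduced_cost_def algebra_simps)
qed

text \<open>\<open>c'\<close> is the smallest value above \<open>c\<close>. Moving there turns the
  strict count at \<open>c\<close> into the weak count at the right endpoint used by
  \<open>reduced_cost_diff_le\<close>.\<close>

lemma ex_next_value:
  fixes p :: "nat \<Rightarrow> real"
  assumes "card {i\<in>{1..N}. p i > c} > 0"
  obtains c' where "c' > c" "card {i\<in>{1..N}. p i > c} \<le> card {i\<in>{1..N}. p i \<ge> c'}"
proof
  let ?A = "{i\<in>{1..N}. p i > c}"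
  have ne: "?A \<noteq> {}" "finite ?A" using assms by (auto simp: card_gt_0_iff)
  show "Min (p ` ?A) > c" using ne by (subst Min_gr_iff) auto
  show "card ?A \<le> card {i\<in>{1..N}. p i \<ge> Min (p ` ?A)}"
    using ne by (intro card_mono) auto
qed

text \<open>The smallest minimizer of a convex function is at most \<open>c\<close> exactly when the
  right derivative at \<open>c\<close>, here 1 minus \<rho> times the count, is nonnegative.\<close>

lemma smallest_optimal_le_iff:
  assumes "\<rho> > 0" "relaxed_optimal \<rho> N p e \<xi>" "c \<ge> 0"
    and smallest: "\<And>e' \<xi>'. relaxed_optimal \<rho> N p e' \<xi>' \<Longrightarrow> e \<le> e'"
  shows "e \<le> c \<longleftrightarrow> real (card {i\<in>{1..N}. p i > c}) \<le> 1 / \<rho>"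
proof
  assume "e \<le> c"
  show "real (card {i\<in>{1..N}. p i > c}) \<le> 1 / \<rho>"
  proof (rule ccontr)
    assume "\<not> ?thesis"
    then have gt: "1 < \<rho> * card {i\<in>{1..N}. p i > c}" using assms(1) by (simp add: field_simps)
    then have "card {i\<in>{1..N}. p i > c} > 0"
      by (intro gr0I) (simp only: of_nat_0 mult_zero_right not_one_less_zero)
    then obtain c' where c': "c' > c" "card {i\<in>{1..N}. p i > c} \<le> card {i\<in>{1..N}. p i \<ge> c'}"
      by (rule ex_next_value)
    have "\<rho> * card {i\<in>{1..N}. p i > c} \<le> \<rho> * card {i\<in>{1..N}. p i \<ge> c'}"
      using c' assms(1) by simp
    then have "(1 - \<rho> * card {i\<in>{1..N}. p i \<ge> c'}) * (c' - e) < 0"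
      using gt c'(1) \<open>e \<le> c\<close> by (intro mult_neg_pos) linarith+
    then have "reduced_cost \<rho> N p c' < reduced_cost \<rho> N p e"
      using reduced_cost_diff_le[of \<rho> e c' N p] assms(1) c' \<open>e \<le> c\<close> by linarith
    moreover have "reduced_cost \<rho> N p e \<le> reduced_cost \<rho> N p c'"
      using assms(1-3) c'(1) by (simp add: relaxed_optimal_iff)
    ultimately show False by simp
  qed
next
  assume le: "real (card {i\<in>{1..N}. p i > c}) \<le> 1 / \<rho>"
  show "e \<le> c"
  proof (rule ccontr)
    assume "\<not> e \<le> c"
    moreover have "0 \<le> 1 - \<rho> * card {i\<in>{1..N}. p i > c}"
      using le assms(1) by (simp add: field_simps)
    ultimately have "0 \<le> (1 - \<rho> * card {i\<in>{1..N}. p i > c}) * (e - c)" by simp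
    \<comment> \<open>So \<open>c\<close> is no worse than the optimal \<open>e\<close>, hence
      itself optimal and below the smallest optimal value.\<close>
    then have "reduced_cost \<rho> N p c \<le> reduced_cost \<rho> N p e"
      using reduced_cost_diff_ge[of \<rho> c e N p] assms(1) \<open>\<not> e \<le> c\<close> by linarith
    then have "relaxed_optimal \<rho> N p c (\<lambda>i. max 0 (p i - c))"
      using assms(1-3) by (force simp: relaxed_optimal_iff intro: order_trans)
    then show False using smallest \<open>\<not> e \<le> c\<close> by blast
  qed
qed

text \<open>Same slope argument, now strict: a zero right derivative at \<open>c\<close> would leave
  minimizers to the right of \<open>c\<close>.\<close>

lemma largest_optimal_le_iff:
  assumes "\<rho> > 0" "relaxed_optimal \<rho> N p e \<xi>" "c \<ge> 0"
    and largest: "\<And>e' \<xi>'. relaxed_optimal \<rho> N p e' \<xi>' \<Longrightarrow> e' \<le> e"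
  shows "e \<le> c \<longleftrightarrow> real (card {i\<in>{1..N}. p i > c}) < 1 / \<rho>"
proof
  assume "e \<le> c"
  show "real (card {i\<in>{1..N}. p i > c}) < 1 / \<rho>"
  proof (rule ccontr)
    assume "\<not> ?thesis"
    then have gt: "1 \<le> \<rho> * card {i\<in>{1..N}. p i > c}" using assms(1) by (simp add: field_simps)
    then have "card {i\<in>{1..N}. p i > c} > 0"
      by (intro gr0I) (simp only: of_nat_0 mult_zero_right not_one_le_zero)
    then obtain c' where c': "c' > c" "card {i\<in>{1..N}. p i > c} \<le> card {i\<in>{1..N}. p i \<ge> c'}"
      by (rule ex_next_value)
    have "\<rho> * card {i\<in>{1..N}. p i > c} \<le> \<rho> * card {i\<in>{1..N}. p i \<ge> c'}"
      using c' assms(1) by simp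
    then have "(1 - \<rho> * card {i\<in>{1..N}. p i \<ge> c'}) * (c' - e) \<le> 0"
      using gt c'(1) \<open>e \<le> c\<close> by (intro mult_nonpos_nonneg) linarith+
    then have "reduced_cost \<rho> N p c' \<le> reduced_cost \<rho> N p e"
      using reduced_cost_diff_le[of \<rho> e c' N p] assms(1) c' \<open>e \<le> c\<close> by linarith
    then have "relaxed_optimal \<rho> N p c' (\<lambda>i. max 0 (p i - c'))"
      using assms(1-3) c' by (force simp: relaxed_optimal_iff intro: order_trans)
    then show False using largest c'(1) \<open>e \<le> c\<close> by force
  qed
next
  assume le: "real (card {i\<in>{1..N}. p i > c}) < 1 / \<rho>"
  show "e \<le> c"
  proof (rule ccontr)
    assume "\<not> e \<le> c"
    moreover have "0 < 1 - \<rho> * card {i\<in>{1..N}. p i > c}"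
      using le assms(1) by (simp add: field_simps)
    ultimately have "0 < (1 - \<rho> * card {i\<in>{1..N}. p i > c}) * (e - c)" by simp
    then have "reduced_cost \<rho> N p c < reduced_cost \<rho> N p e"
      using reduced_cost_diff_ge[of \<rho> c e N p] assms(1) \<open>\<not> e \<le> c\<close> by linarith
    then show False using assms(1-3) by (force simp: relaxed_optimal_iff)
  qed
qed

text \<open>The equivalence says that \<open>fst (sol x)\<close> is the \<open>s\<close>-th largest
  sampled value cut off at 0, and 0 if \<open>s > N\<close>. One \<open>s\<close> serves all samples
  in \<open>S\<close>, since \<rho> and the tie-break are fixed; this makes order statistics
  applicable.\<close>

lemma tie_broken_solution_le_iff:
  assumes "\<rho> > 0" "tie_broken_solution \<rho> N g S sol"
  shows "\<exists>s\<ge>1. \<forall>x\<in>S. \<forall>c\<ge>0. fst (sol x) \<le> c \<longleftrightarrow> card {i\<in>{1..N}. g (x i) > c} < s"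
proof -
  have opt: "relaxed_optimal \<rho> N (g \<circ> x) (fst (sol x)) (snd (sol x))" if "x \<in> S" for x
    using assms(2) that by (simp add: tie_broken_solution_def)
  have "1 / \<rho> > 0" using assms(1) by simp
  consider (smallest) "\<forall>x\<in>S. \<forall>e \<xi>. relaxed_optimal \<rho> N (g \<circ> x) e \<xi> \<longrightarrow> fst (sol x) \<le> e"
    | (largest) "\<forall>x\<in>S. \<forall>e \<xi>. relaxed_optimal \<rho> N (g \<circ> x) e \<xi> \<longrightarrow> e \<le> fst (sol x)"
    using assms(2) by (auto simp: tie_broken_solution_def)
  then show ?thesis
  proof cases
    case smallest
    \<comment> \<open>The weak inequality gives the floor plus one; the strict one of the other
      tie-break gives the ceiling. They differ only if \<open>1 / \<rho>\<close> is an
      integer.\<close>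
    have "n < nat \<lfloor>1 / \<rho>\<rfloor> + 1 \<longleftrightarrow> real n \<le> 1 / \<rho>" for n
      using \<open>1 / \<rho> > 0\<close> by (simp add: less_Suc_eq_le le_nat_floor le_nat_iff le_floor_iff)
    then show ?thesis
      using smallest_optimal_le_iff[OF assms(1) opt] smallest
      by (intro exI[of _ "nat \<lfloor>1 / \<rho>\<rfloor> + 1"]) (simp add: comp_def)
  next
    case largest
    have "n < nat \<lceil>1 / \<rho>\<rceil> \<longleftrightarrow> real n < 1 / \<rho>" for n
      by (simp add: less_ceiling_iff zless_nat_eq_int_zless)
    moreover have "nat \<lceil>1 / \<rho>\<rceil> \<ge> 1" using \<open>1 / \<rho> > 0\<close> by (simp add: Suc_le_eq)
    ultimately show ?thesis
      using largest_optimal_le_iff[OF assms(1) opt] largest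
      by (intro exI[of _ "nat \<lceil>1 / \<rho>\<rceil>"]) (simp add: comp_def)
  qed
qed

lemma num_relaxed_optimal:
  assumes "\<rho> > 0" "relaxed_optimal \<rho> N p e \<xi>"
  shows "num_relaxed N \<xi> = card {i\<in>{1..N}. p i > e}"
proof -
  have "\<xi> i > 0 \<longleftrightarrow> p i > e" if "i \<in> {1..N}" for i
    using assms that by (auto simp: relaxed_optimal_iff)
  then show ?thesis unfolding num_relaxed_def by (metis (no_types, lifting))
qed

subsection \<open>Roots of the defining polynomials\<close>

lemma continuous_on_eps_poly: "continuous_on S (eps_poly N \<beta> q)"
  unfolding eps_poly_def by (intro continuous_intros)

text \<open>The summand \<open>i = N + 1\<close> of the last sum is at least \<open>t\<close> times
  the leading term; with weight \<open>\<beta> / (6 * N)\<close> it wins once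
  \<open>t > 6 * N / \<beta>\<close>.\<close>

lemma eps_poly_neg_of_large:
  assumes "\<beta> > 0" "N \<ge> 1" "q \<le> N" "t > 6 * real N / \<beta>"
  shows "eps_poly N \<beta> q t < 0"
proof -
  have "t > 0" using assms by (intro le_less_trans[OF _ assms(4)]) simp
  have pos: "real (N choose q) * t ^ (N - q) > 0" using assms \<open>t > 0\<close> by simp
  have "real (N choose q) * t ^ (N - q) * t \<le> real (Suc N choose q) * t ^ (Suc N - q)"
    using assms \<open>t > 0\<close> binomial_right_mono[of N "Suc N" q] by (simp add: Suc_diff_le mult_right_mono)
  also have "\<dots> \<le> (\<Sum>i=N+1..4*N. real (i choose q) * t ^ (i - q))"
    using assms \<open>t > 0\<close> by (intro member_le_sum) auto
  finally have "\<beta> / (6 * real N) * (real (N choose q) * t ^ (N - q) * t) \<le>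
      \<beta> / (6 * real N) * (\<Sum>i=N+1..4*N. real (i choose q) * t ^ (i - q))"
    using assms by (intro mult_left_mono) auto
  moreover have "0 \<le> \<beta> / (2 * real N) * (\<Sum>i=q..<N. real (i choose q) * t ^ (i - q))"
    using assms \<open>t > 0\<close> by (intro mult_nonneg_nonneg sum_nonneg) auto
  moreover have "real (N choose q) * t ^ (N - q) < \<beta> / (6 * real N) * (real (N choose q) * t ^ (N - q) * t)"
  proof -
    have "1 < \<beta> * t / (6 * real N)" using assms by (simp add: field_simps)
    from mult_strict_left_mono[OF this pos] show ?thesis by (simp add: ac_simps)
  qed
  ultimately show ?thesis unfolding eps_poly_def by linarith
qed

text \<open>At 0 the leading term vanishes because \<open>q < N\<close>, while the summand
  \<open>i = q\<close> of the first sum equals 1.\<close>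

lemma eps_poly_0_neg:
  assumes "\<beta> > 0" "N \<ge> 1" "q < N"
  shows "eps_poly N \<beta> q 0 < 0"
proof -
  have "(1::real) = real (q choose q) * 0 ^ (q - q)" by simp
  also have "\<dots> \<le> (\<Sum>i=q..<N. real (i choose q) * 0 ^ (i - q))"
    using assms by (intro member_le_sum[of q _ "\<lambda>i. real (i choose q) * 0 ^ (i - q)"]) auto
  finally have "0 < \<beta> / (2 * real N) * (\<Sum>i=q..<N. real (i choose q) * 0 ^ (i - q))"
    using assms by (intro mult_pos_pos) auto
  moreover have "0 \<le> \<beta> / (6 * real N) * (\<Sum>i=N+1..4*N. real (i choose q) * 0 ^ (i - q))"
    using assms by (intro mult_nonneg_nonneg sum_nonneg) auto
  moreover have "(0::real) ^ (N - q) = 0" using assms by simp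
  ultimately show ?thesis unfolding eps_poly_def by (simp only: mult_zero_right)
qed

text \<open>Makes \<open>Min\<close> and \<open>Max\<close> in \<open>t_low\<close> and
  \<open>t_high\<close> meaningful.\<close>

lemma finite_eps_poly_roots:
  assumes "\<beta> > 0" "N \<ge> 1" "q < N"
  shows "finite {t. 0 \<le> t \<and> eps_poly N \<beta> q t = 0}"
proof -
  define P where "P = monom (real (N choose q)) (N - q)
    - smult (\<beta> / (2 * real N)) (\<Sum>i=q..<N. monom (real (i choose q)) (i - q))
    - smult (\<beta> / (6 * real N)) (\<Sum>i=N+1..4*N. monom (real (i choose q)) (i - q))"
  have P: "poly P t = eps_poly N \<beta> q t" for t
    by (simp add: P_def eps_poly_def poly_sum poly_monom)
  have "P \<noteq> 0" using P[of 0] eps_poly_0_neg[OF assms] by auto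
  then have "finite {t. poly P t = 0}" by (rule poly_roots_finite)
  then show ?thesis by (rule finite_subset[rotated]) (auto simp: P)
qed

lemma eps_poly_root_above:
  assumes "\<beta> > 0" "N \<ge> 1" "q \<le> N" "eps_poly N \<beta> q t > 0"
  obtains u where "u > t" "eps_poly N \<beta> q u = 0"
proof -
  define T where "T = max t (6 * real N / \<beta>) + 1"
  have "eps_poly N \<beta> q T < 0" using assms by (intro eps_poly_neg_of_large) (auto simp: T_def)
  moreover have "t \<le> T" by (simp add: T_def)
  ultimately obtain u where "t \<le> u" "u \<le> T" "eps_poly N \<beta> q u = 0"
    using IVT2'[of "eps_poly N \<beta> q" T 0 t] assms(4) continuous_on_eps_poly by auto
  then show thesis using assms(4) by (intro that[of u]) (auto simp: less_le)
qed

lemma eps_poly_root_below: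
  assumes "\<beta> > 0" "N \<ge> 1" "q < N" "t \<ge> 0" "eps_poly N \<beta> q t > 0"
  obtains u where "0 \<le> u" "u < t" "eps_poly N \<beta> q u = 0"
proof -
  obtain u where "0 \<le> u" "u \<le> t" "eps_poly N \<beta> q u = 0"
    using IVT'[of "eps_poly N \<beta> q" 0 0 t] assms continuous_on_eps_poly eps_poly_0_neg[OF assms(1-3)]
    by auto
  then show thesis using assms(5) by (intro that[of u]) (auto simp: less_le)
qed

text \<open>For \<open>q = N\<close> the leading term is 1 and the first sum is empty, so the
  function decreases strictly from 1 on the nonnegative axis and is eventually negative.\<close>

lemma eps_poly_N_root_unique:
  assumes "\<beta> > 0" "N \<ge> 1"
  shows "\<exists>!t. 0 \<le> t \<and> eps_poly N \<beta> N t = 0"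
proof -
  have anti: "eps_poly N \<beta> N u < eps_poly N \<beta> N t" if "0 \<le> t" "t < u" for t u
  proof -
    have "(\<Sum>i=N+1..4*N. real (i choose N) * t ^ (i - N)) < (\<Sum>i=N+1..4*N. real (i choose N) * u ^ (i - N))"
      using assms that by (intro sum_strict_mono mult_strict_left_mono power_strict_mono) auto
    then show ?thesis using assms by (simp add: eps_poly_def divide_strict_right_mono)
  qed
  have "eps_poly N \<beta> N 0 = 1" by (auto simp: eps_poly_def intro!: sum.neutral)
  then obtain u where "u > 0" "eps_poly N \<beta> N u = 0"
    using eps_poly_root_above[OF assms order_refl, of 0] by auto
  then show ?thesis using anti by (metis less_imp_le less_irrefl linorder_neqE)
qed

text \<open>The range \<open>q \<ge> N\<close> includes the complexity \<open>N + 1\<close>, which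
  occurs when all constraints are relaxed.\<close>

lemma t_high_N:
  assumes "\<beta> > 0" "N \<ge> 1" "q \<ge> N"
  shows "0 \<le> t_high N \<beta> q"
    "\<And>u. 0 \<le> u \<Longrightarrow> eps_poly N \<beta> N u = 0 \<Longrightarrow> u = t_high N \<beta> q"
  using theI'[OF eps_poly_N_root_unique[OF assms(1,2)]] eps_poly_N_root_unique[OF assms(1,2)] assms(3)
  by (auto simp: t_high_def)

text \<open>A positive value lies between two roots, so this needs no lower bound on the number of roots.\<close>

lemma eps_poly_nonpos_outside:
  assumes "\<beta> > 0" "N \<ge> 1" "q \<le> N" "0 \<le> t" "t \<notin> {t_low N \<beta> q..t_high N \<beta> q}"
  shows "eps_poly N \<beta> q t \<le> 0"
proof (rule ccontr)
  assume "\<not> ?thesis"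
  then have pos: "eps_poly N \<beta> q t > 0" by simp
  obtain u where u: "u > t" "eps_poly N \<beta> q u = 0"
    using eps_poly_root_above[OF assms(1-3) pos] .
  show False
  proof (cases "q < N")
    case True
    let ?R = "{t. 0 \<le> t \<and> eps_poly N \<beta> q t = 0}"
    obtain v where "0 \<le> v" "v < t" "eps_poly N \<beta> q v = 0"
      using eps_poly_root_below[OF assms(1,2) True assms(4) pos] .
    then have "t_low N \<beta> q \<le> v" "u \<le> t_high N \<beta> q"
      using finite_eps_poly_roots[OF assms(1,2) True] True u assms(4)
      by (auto simp: t_low_def t_high_def intro!: Min_le Max_ge)
    then show False using \<open>v < t\<close> u(1) assms(5) by auto
  next
    \<comment> \<open>Since \<open>t_low\<close> is 0 and \<open>u\<close> is the root
      \<open>t_high\<close>, the inequalities \<open>0 \<le> t < u\<close> place \<open>t\<close>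
      inside the interval.\<close>
    case False
    then have "q = N" using assms(3) by simp
    moreover have "t_low N \<beta> q = 0" using False by (simp add: t_low_def)
    ultimately show False using t_high_N(2)[of \<beta> N q u] assms u by auto
  qed
qed

subsection \<open>Order statistics of independent samples\<close>

text \<open>Counting the larger values is injective on \<open>J\<close> and maps into
  \<open>{..<card J}\<close>, hence onto it.\<close>

lemma ex_rank:
  fixes p :: "'i \<Rightarrow> real"
  assumes "finite J" "inj_on p J" "n < card J"
  obtains j where "j \<in> J" "card {i\<in>J. p i > p j} = n"
proof -
  let ?r = "\<lambda>j. card {i\<in>J. p i > p j}"
  have less: "?r j < ?r i" if "i \<in> J" "j \<in> J" "p i < p j" for i j
    using that assms(1) by (intro psubset_card_mono) auto
  have "inj_on ?r J"
  proof (rule inj_onI)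
    fix i j assume "i \<in> J" "j \<in> J" "?r i = ?r j"
    then have "p i = p j" using less[of i j] less[of j i] by (metis less_irrefl linorder_neqE)
    then show "i = j" using assms(2) \<open>i \<in> J\<close> \<open>j \<in> J\<close> by (auto dest: inj_onD)
  qed
  then have "card (?r ` J) = card {..<card J}" by (simp add: card_image)
  moreover have "?r ` J \<subseteq> {..<card J}"
    using assms(1) by (auto intro!: psubset_card_mono)
  ultimately have "?r ` J = {..<card J}" by (intro card_subset_eq) auto
  then show thesis using assms(3) that by (metis (no_types, lifting) imageE lessThan_iff)
qed

text \<open>
  A cell \<open>(j, A)\<close> fixes the index \<open>j\<close> of the \<open>s\<close>-th largest value and the set \<open>A\<close> of indices of the
  larger ones.
\<close>

definition rank_cells :: "nat set \<Rightarrow> nat \<Rightarrow> (nat \<times> nat set) set" where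
  "rank_cells J s = (SIGMA j:J. {A. A \<subseteq> J - {j} \<and> card A = s - 1})"

lemma finite_rank_cells: "finite J \<Longrightarrow> finite (rank_cells J s)"
  unfolding rank_cells_def
  by (intro finite_SigmaI finite_subset[where B = "Pow J" and A = "{A. A \<subseteq> J - {_} \<and> _ A}"]) auto

text \<open>Choosing \<open>j\<close> first and then \<open>A\<close> among the remaining indices
  gives \<open>n * (n - 1 choose s - 1) = s * (n choose s)\<close>.\<close>

lemma card_rank_cells:
  assumes "finite J" "s \<ge> 1"
  shows "card (rank_cells J s) = s * (card J choose s)"
proof -
  have "card (rank_cells J s) = (\<Sum>j\<in>J. card {A. A \<subseteq> J - {j} \<and> card A = s - 1})"
    unfolding rank_cells_def
    using assms(1) by (intro card_SigmaI) (auto intro: finite_subset[where B = "Pow J"])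
  also have "\<dots> = (\<Sum>j\<in>J. (card J - 1) choose (s - 1))"
    using assms(1) by (intro sum.cong refl) (simp add: n_subsets)
  also have "\<dots> = s * (card J choose s)"
    using assms(2) times_binomial_minus1_eq[of s "card J"] by simp
  finally show ?thesis .
qed

section \<open>Ordering events for samples from a law without atoms\<close>

locale continuous_rv = prob_space M for M :: "'a measure" +
  fixes g :: "'a \<Rightarrow> real"
  assumes g_meas[measurable]: "g \<in> borel_measurable M"
    and no_atom: "measure M {x\<in>space M. g x = c} = 0"
begin

lemma risk_le_1: "risk M g c \<le> 1" and risk_ge_0: "0 \<le> risk M g c"
  by (simp_all add: risk_def)

text \<open>The risk is antitone, and monotone real functions are Borel; hence the double
  negation.\<close>

lemma risk_measurable[measurable]: "risk M g \<in> borel_measurable borel"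
proof -
  have "mono (\<lambda>c. - risk M g c)"
    by (intro monoI) (auto simp: risk_def intro!: finite_measure_mono)
  then have "(\<lambda>c. - (- risk M g c)) \<in> borel_measurable borel"
    by (intro borel_measurable_uminus borel_measurable_mono)
  then show ?thesis by simp
qed

text \<open>Adding the null event \<open>g = c\<close> turns \<open>g < c\<close> into the
  complement of \<open>g > c\<close>.\<close>

lemma prob_less: "measure M {x\<in>space M. g x < c} = 1 - risk M g c"
proof -
  have "measure M {x\<in>space M. g x < c} = measure M ({x\<in>space M. g x < c} \<union> {x\<in>space M. g x = c})"
    by (subst finite_measure_Union) (auto simp: no_atom)
  also have "{x\<in>space M. g x < c} \<union> {x\<in>space M. g x = c} = space M - {x\<in>space M. g x > c}"
    by auto
  also have "measure M \<dots> = 1 - risk M g c"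
    unfolding risk_def by (rule prob_compl) simp
  finally show ?thesis .
qed

lemma prob_space_samples: "prob_space (Pi\<^sub>M I (\<lambda>_::nat. M))"
  by (intro prob_space_PiM prob_space_axioms)

lemma component_meas[measurable]: "i \<in> I \<Longrightarrow> (\<lambda>x. g (x i)) \<in> borel_measurable (Pi\<^sub>M I (\<lambda>_::nat. M))"
  by measurable

text \<open>Strict inequalities on both sides make different cells disjoint; samples with a tie at
  \<open>j\<close> are dropped.\<close>

definition rank_event :: "nat set \<Rightarrow> nat \<Rightarrow> nat set \<Rightarrow> (nat \<Rightarrow> 'a) set" where
  "rank_event J j A = {x\<in>space (Pi\<^sub>M J (\<lambda>_. M)).
     (\<forall>i\<in>A. g (x i) > g (x j)) \<and> (\<forall>i\<in>J - {j} - A. g (x i) < g (x j))}"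

lemma sets_rank_event:
  assumes "finite J" "j \<in> J" "A \<subseteq> J"
  shows "rank_event J j A \<in> sets (Pi\<^sub>M J (\<lambda>_. M))"
proof -
  have fin: "finite A" "finite (J - {j} - A)" using assms finite_subset by auto
  show ?thesis unfolding rank_event_def
    using assms fin
    by (intro sets.sets_Collect_conj sets.sets_Collect_finite_All borel_measurable_less component_meas) auto
qed

lemma sets_rank_event_in:
  assumes "finite J" "j \<in> J" "A \<subseteq> J" "B \<in> sets borel"
  shows "{x\<in>rank_event J j A. g (x j) \<in> B} \<in> sets (Pi\<^sub>M J (\<lambda>_. M))"
proof -
  have "{x\<in>rank_event J j A. g (x j) \<in> B} =
      rank_event J j A \<inter> ((\<lambda>x. g (x j)) -` B \<inter> space (Pi\<^sub>M J (\<lambda>_. M)))"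
    by (auto simp: rank_event_def)
  then show ?thesis
    using measurable_sets[OF component_meas[OF assms(2)] assms(4)] sets_rank_event[OF assms(1-3)]
    by simp
qed

text \<open>Integrate over coordinate \<open>j\<close> last. Given its value, the event is a box in
  the other independent coordinates, with sides of probability \<open>V\<close> for indices in
  \<open>A\<close> and \<open>1 - V\<close> for the rest.\<close>

lemma emeasure_rank_event:
  assumes "finite J" "j \<in> J" "A \<subseteq> J - {j}" "B \<in> sets borel"
  shows "emeasure (Pi\<^sub>M J (\<lambda>_. M)) {x\<in>rank_event J j A. g (x j) \<in> B} =
    (\<integral>\<^sup>+ y. ennreal (indicator B (g y) * risk M g (g y) ^ card A *
      (1 - risk M g (g y)) ^ (card J - 1 - card A)) \<partial>M)"
proof -
  interpret samples: product_sigma_finite "\<lambda>_::nat. M" ..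
  define I where "I = J - {j}"
  have I: "finite I" "j \<notin> I" "J = insert j I" "A \<subseteq> I" "finite A"
    using assms finite_subset by (auto simp: I_def)
  let ?E = "{x\<in>rank_event J j A. g (x j) \<in> B}"
  have E_sets: "?E \<in> sets (Pi\<^sub>M J (\<lambda>_. M))"
    using assms by (intro sets_rank_event_in) auto
  have "emeasure (Pi\<^sub>M J (\<lambda>_. M)) ?E = (\<integral>\<^sup>+ x. indicator ?E x \<partial>Pi\<^sub>M J (\<lambda>_. M))"
    using E_sets by simp
  also have "\<dots> = (\<integral>\<^sup>+ y. (\<integral>\<^sup>+ x. indicator ?E (x(j := y)) \<partial>Pi\<^sub>M I (\<lambda>_. M)) \<partial>M)"
    using E_sets unfolding I(3)
    by (intro samples.product_nn_integral_insert_rev I borel_measurable_indicator)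
  also have "\<dots> = (\<integral>\<^sup>+ y. ennreal (indicator B (g y) * risk M g (g y) ^ card A *
      (1 - risk M g (g y)) ^ (card J - 1 - card A)) \<partial>M)"
  proof (rule nn_integral_cong)
    fix y assume y: "y \<in> space M"
    \<comment> \<open>The sides of the box.\<close>
    define X where "X i = (if i \<in> A then {u\<in>space M. g u > g y} else {u\<in>space M. g u < g y})" for i
    have X: "X i \<in> sets M" for i by (simp add: X_def)
    have "(\<integral>\<^sup>+ x. indicator ?E (x(j := y)) \<partial>Pi\<^sub>M I (\<lambda>_. M)) =
        (\<integral>\<^sup>+ x. indicator B (g y) * indicator (Pi\<^sub>E I X) x \<partial>Pi\<^sub>M I (\<lambda>_. M))"
    proof (rule nn_integral_cong)
      fix x assume x: "x \<in> space (Pi\<^sub>M I (\<lambda>_. M))"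
      have "x(j := y) \<in> space (Pi\<^sub>M J (\<lambda>_. M))"
        using x y I by (auto simp: space_PiM PiE_iff extensional_def)
      then have "x(j := y) \<in> ?E \<longleftrightarrow> g y \<in> B \<and>
          (\<forall>i\<in>A. g ((x(j := y)) i) > g y) \<and> (\<forall>i\<in>I - A. g ((x(j := y)) i) < g y)"
        by (auto simp: rank_event_def I_def)
      also have "\<dots> \<longleftrightarrow> g y \<in> B \<and> (\<forall>i\<in>A. g (x i) > g y) \<and> (\<forall>i\<in>I - A. g (x i) < g y)"
        using I(2,4) by (metis DiffD1 fun_upd_apply subsetD)
      also have "\<dots> \<longleftrightarrow> g y \<in> B \<and> (\<forall>i\<in>I. x i \<in> X i)"
        using x I(4) by (auto simp: X_def space_PiM PiE_iff)
      finally have "x(j := y) \<in> ?E \<longleftrightarrow> g y \<in> B \<and> (\<forall>i\<in>I. x i \<in> X i)" .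
      moreover have "x \<in> Pi\<^sub>E I X \<longleftrightarrow> (\<forall>i\<in>I. x i \<in> X i)"
        using x by (auto simp: space_PiM PiE_iff)
      ultimately show "indicator ?E (x(j := y)) = (indicator B (g y) * indicator (Pi\<^sub>E I X) x :: ennreal)"
        by (simp add: indicator_def)
    qed
    also have "\<dots> = indicator B (g y) * (\<Prod>i\<in>I. emeasure M (X i))"
      using X I by (simp add: nn_integral_cmult samples.emeasure_PiM sets_PiM_I_finite)
    also have "(\<Prod>i\<in>I. emeasure M (X i)) = ennreal (\<Prod>i\<in>I. measure M (X i))"
      by (simp add: emeasure_eq_measure prod_ennreal)
    also have "(\<Prod>i\<in>I. measure M (X i)) = (\<Prod>i\<in>A. measure M (X i)) * (\<Prod>i\<in>I - A. measure M (X i))"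
      using I by (metis prod.subset_diff mult.commute)
    also have "(\<Prod>i\<in>A. measure M (X i)) = risk M g (g y) ^ card A"
      by (simp add: X_def risk_def)
    also have "(\<Prod>i\<in>I - A. measure M (X i)) = (1 - risk M g (g y)) ^ card (I - A)"
      by (simp add: X_def prob_less)
    also have "card (I - A) = card J - 1 - card A"
      using I by (simp add: card_Diff_subset)
    also have "indicator B (g y) * ennreal (risk M g (g y) ^ card A * (1 - risk M g (g y)) ^ (card J - 1 - card A))
      = ennreal (indicator B (g y) * risk M g (g y) ^ card A * (1 - risk M g (g y)) ^ (card J - 1 - card A))"
      by (simp add: indicator_def)
    finally show "(\<integral>\<^sup>+ x. indicator ?E (x(j := y)) \<partial>Pi\<^sub>M I (\<lambda>_. M)) = \<dots>" .
  qed
  finally show ?thesis .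
qed

section \<open>Almost sure absence of ties\<close>

lemma AE_no_tie:
  fixes J :: "nat set"
  assumes "finite J" "i \<in> J" "j \<in> J" "i \<noteq> j"
  shows "AE x in Pi\<^sub>M J (\<lambda>_. M). g (x i) \<noteq> g (x j)"
proof -
  interpret samples: product_sigma_finite "\<lambda>_::nat. M" ..
  define I where "I = J - {i}"
  have I: "finite I" "i \<notin> I" "J = insert i I" "j \<in> I" using assms by (auto simp: I_def)
  let ?E = "{x\<in>space (Pi\<^sub>M J (\<lambda>_. M)). g (x i) = g (x j)}"
  have E_sets: "?E \<in> sets (Pi\<^sub>M J (\<lambda>_. M))"
    using component_meas[OF assms(2)] component_meas[OF assms(3)] by (rule borel_measurable_eq)
  have "emeasure (Pi\<^sub>M J (\<lambda>_. M)) ?E = (\<integral>\<^sup>+ x. indicator ?E x \<partial>Pi\<^sub>M J (\<lambda>_. M))"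
    using E_sets by simp
  also have "\<dots> = (\<integral>\<^sup>+ x. (\<integral>\<^sup>+ y. indicator ?E (x(i := y)) \<partial>M) \<partial>Pi\<^sub>M I (\<lambda>_. M))"
    using E_sets unfolding I(3)
    by (intro samples.product_nn_integral_insert I borel_measurable_indicator)
  also have "\<dots> = (\<integral>\<^sup>+ x. 0 \<partial>Pi\<^sub>M I (\<lambda>_. M))"
  proof (rule nn_integral_cong)
    fix x assume x: "x \<in> space (Pi\<^sub>M I (\<lambda>_. M))"
    \<comment> \<open>With the other coordinates fixed, a tie confines coordinate \<open>i\<close>
      to a single level of \<open>g\<close>, a null event.\<close>
    have "(\<integral>\<^sup>+ y. indicator ?E (x(i := y)) \<partial>M) = (\<integral>\<^sup>+ y. indicator {u\<in>space M. g u = g (x j)} y \<partial>M)"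
      using x I assms(4)
      by (intro nn_integral_cong) (auto simp: indicator_def space_PiM PiE_iff extensional_def)
    also have "\<dots> = 0" by (simp add: emeasure_eq_measure no_atom)
    finally show "(\<integral>\<^sup>+ y. indicator ?E (x(i := y)) \<partial>M) = 0" .
  qed
  finally have "emeasure (Pi\<^sub>M J (\<lambda>_. M)) ?E = 0" by simp
  then show ?thesis using E_sets by (intro AE_I[where N = ?E]) auto
qed

lemma AE_inj_on:
  fixes J :: "nat set"
  assumes "finite J"
  shows "AE x in Pi\<^sub>M J (\<lambda>_. M). inj_on (\<lambda>i. g (x i)) J"
proof -
  have "AE x in Pi\<^sub>M J (\<lambda>_. M). \<forall>i\<in>J. \<forall>j\<in>J. i \<noteq> j \<longrightarrow> g (x i) \<noteq> g (x j)"
    using assms AE_no_tie[OF assms] by (intro AE_finite_allI AE_impI) auto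
  then show ?thesis by eventually_elim (auto simp: inj_on_def)
qed

text \<open>For \<open>1 \<le> s \<le> card J\<close> and up to ties, the event that the
  \<open>s\<close>-th largest value lies in \<open>B\<close>.\<close>

definition rank_value_in :: "nat set \<Rightarrow> nat \<Rightarrow> real set \<Rightarrow> (nat \<Rightarrow> 'a) set" where
  "rank_value_in J s B = (\<Union>(j, A)\<in>rank_cells J s. {x\<in>rank_event J j A. g (x j) \<in> B})"

text \<open>On the event \<open>A\<close> is recovered from \<open>x\<close> and \<open>j\<close>,
  so cells sharing \<open>j\<close> cannot overlap.\<close>

lemma rank_event_cell:
  assumes "x \<in> rank_event J j A" "A \<subseteq> J - {j}"
  shows "A = {i\<in>J. g (x i) > g (x j)}"
proof (intro equalityI subsetI)
  fix i assume "i \<in> A"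
  then show "i \<in> {i\<in>J. g (x i) > g (x j)}"
    using assms unfolding rank_event_def by blast
next
  fix i assume i: "i \<in> {i\<in>J. g (x i) > g (x j)}"
  show "i \<in> A"
  proof (rule ccontr)
    assume "i \<notin> A"
    then have "i \<in> J - {j} - A" using i by auto
    then have "g (x i) < g (x j)" using assms(1) unfolding rank_event_def by blast
    then show False using i by simp
  qed
qed

text \<open>Different indices would carry different values, hence different numbers of larger
  values, yet both numbers equal \<open>s - 1\<close>.\<close>

lemma disjoint_rank_events:
  assumes "finite J"
  shows "disjoint_family_on (\<lambda>(j, A). {x\<in>rank_event J j A. g (x j) \<in> B}) (rank_cells J s)"
proof -
  have eq: "(j, A) = (j', A')"
    if c: "(j, A) \<in> rank_cells J s" "(j', A') \<in> rank_cells J s"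
      and x: "x \<in> rank_event J j A" "x \<in> rank_event J j' A'" for j A j' A' x
  proof -
    have J: "j \<in> J" "j' \<in> J" and card: "card A = card A'"
      and sub: "A \<subseteq> J - {j}" "A' \<subseteq> J - {j'}"
      using c by (auto simp: rank_cells_def)
    note A = rank_event_cell[OF x(1) sub(1)] rank_event_cell[OF x(2) sub(2)]
    have less: "card {i\<in>J. g (x i) > g (x v)} < card {i\<in>J. g (x i) > g (x u)}"
      if "v \<in> J" "g (x u) < g (x v)" for u v
    proof (rule psubset_card_mono)
      have "v \<in> {i\<in>J. g (x i) > g (x u)} - {i\<in>J. g (x i) > g (x v)}" using that by simp
      then show "{i\<in>J. g (x i) > g (x v)} \<subset> {i\<in>J. g (x i) > g (x u)}"
        using that(2) by auto
    qed (use assms in simp)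
    have "j = j'"
    proof (rule ccontr)
      assume "j \<noteq> j'"
      then have "g (x j) < g (x j') \<or> g (x j') < g (x j)"
        using x(1) J unfolding rank_event_def by (cases "j' \<in> A") auto
      moreover have "card {i\<in>J. g (x i) > g (x j)} = card {i\<in>J. g (x i) > g (x j')}"
        using card by (simp only: A[symmetric])
      ultimately show False using less[OF J(1), of j'] less[OF J(2), of j] by linarith
    qed
    moreover from this have "A = A'" by (subst A(1), subst A(2)) simp
    ultimately show ?thesis by simp
  qed
  show ?thesis
    unfolding disjoint_family_on_def
  proof (intro ballI impI)
    fix c c' assume c: "c \<in> rank_cells J s" "c' \<in> rank_cells J s" "c \<noteq> c'"
    obtain j A j' A' where "c = (j, A)" "c' = (j', A')" by (cases c, cases c')
    then show "(case c of (j, A) \<Rightarrow> {x\<in>rank_event J j A. g (x j) \<in> B}) \<inter>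
        (case c' of (j, A) \<Rightarrow> {x\<in>rank_event J j A. g (x j) \<in> B}) = {}"
      using eq[of j A j' A'] c by blast
  qed
qed

lemma sets_rank_cell:
  assumes "finite J" "c \<in> rank_cells J s" "B \<in> sets borel"
  shows "(case c of (j, A) \<Rightarrow> {x\<in>rank_event J j A. g (x j) \<in> B}) \<in> sets (Pi\<^sub>M J (\<lambda>_. M))"
  using assms by (auto simp: rank_cells_def intro!: sets_rank_event_in)

text \<open>The cells are disjoint and equally likely, so one integral is multiplied by their
  number.\<close>

lemma emeasure_rank_value_in:
  assumes "finite J" "s \<ge> 1" "B \<in> sets borel"
  shows "emeasure (Pi\<^sub>M J (\<lambda>_. M)) (rank_value_in J s B) = of_nat (s * (card J choose s)) *
    (\<integral>\<^sup>+ y. ennreal (indicator B (g y) * risk M g (g y) ^ (s - 1) *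
      (1 - risk M g (g y)) ^ (card J - s)) \<partial>M)"
proof -
  have "emeasure (Pi\<^sub>M J (\<lambda>_. M)) (rank_value_in J s B) =
      (\<Sum>c\<in>rank_cells J s. emeasure (Pi\<^sub>M J (\<lambda>_. M))
        (case c of (j, A) \<Rightarrow> {x\<in>rank_event J j A. g (x j) \<in> B}))"
    unfolding rank_value_in_def
    using sets_rank_cell[OF assms(1) _ assms(3)]
    by (intro sum_emeasure[symmetric] disjoint_rank_events finite_rank_cells assms) auto
  also have "\<dots> = (\<Sum>c\<in>rank_cells J s. \<integral>\<^sup>+ y. ennreal (indicator B (g y) * risk M g (g y) ^ (s - 1) *
      (1 - risk M g (g y)) ^ (card J - s)) \<partial>M)"
    using assms(2) emeasure_rank_event[OF assms(1) _ _ assms(3)]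
    by (intro sum.cong refl) (auto simp: rank_cells_def)
  finally show ?thesis by (simp add: card_rank_cells[OF assms(1,2)])
qed

lemma prob_rank_value_in:
  assumes "finite J" "s \<ge> 1" "B \<in> sets borel"
  shows "measure (Pi\<^sub>M J (\<lambda>_. M)) (rank_value_in J s B) =
    (\<integral>y. indicator B (g y) * (s * risk M g (g y) ^ (s - 1) *
      ((card J choose s) * (1 - risk M g (g y)) ^ (card J - s))) \<partial>M)"
proof -
  let ?f = "\<lambda>y. indicator B (g y) * risk M g (g y) ^ (s - 1) * (1 - risk M g (g y)) ^ (card J - s)"
  have [measurable]: "B \<in> sets borel" by fact
  have f: "0 \<le> ?f y" for y using risk_le_1 risk_ge_0 by simp
  have "?f y \<le> 1" for y
    using risk_le_1 risk_ge_0 by (intro mult_le_one power_le_one) (auto simp: indicator_def)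
  then have int: "integrable M ?f" using f by (intro integrable_const_bound[of _ 1]) auto
  have "measure (Pi\<^sub>M J (\<lambda>_. M)) (rank_value_in J s B) =
      enn2real (of_nat (s * (card J choose s)) * ennreal (\<integral>y. ?f y \<partial>M))"
    unfolding measure_def emeasure_rank_value_in[OF assms]
    using int f by (subst nn_integral_eq_integral) auto
  also have "\<dots> = (\<integral>y. (s * (card J choose s)) * ?f y \<partial>M)"
    using f by (simp add: enn2real_mult ennreal_of_nat_eq_real_of_nat integral_nonneg)
  finally show ?thesis by (simp add: ac_simps)
qed

text \<open>The factor \<open>w\<close> common to the densities for all sample sizes; for
  \<open>n = s\<close> it is the whole density. The remaining factors are the terms of
  \<open>eps_poly\<close>.\<close>

definition rank_density :: "nat \<Rightarrow> 'a \<Rightarrow> real" where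
  "rank_density s y = s * risk M g (g y) ^ (s - 1)"

lemma rank_density_nonneg: "0 \<le> rank_density s y"
  by (simp add: rank_density_def risk_ge_0)

lemma integrable_rank_density:
  "integrable M (\<lambda>y. rank_density s y * (c * (1 - risk M g (g y)) ^ n))"
proof -
  have "risk M g (g y) ^ (s - 1) * (1 - risk M g (g y)) ^ n \<le> 1" for y
    using risk_le_1 risk_ge_0 by (intro mult_le_one power_le_one) auto
  then have "integrable M (\<lambda>y. risk M g (g y) ^ (s - 1) * (1 - risk M g (g y)) ^ n)"
    using risk_le_1 risk_ge_0 by (intro integrable_const_bound[of _ 1]) auto
  then have "integrable M (\<lambda>y. (s * c) * (risk M g (g y) ^ (s - 1) * (1 - risk M g (g y)) ^ n))"
    by (rule integrable_mult_right)
  then show ?thesis by (simp add: rank_density_def ac_simps)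
qed

text \<open>The integral is a probability under the product of \<open>n\<close> copies of
  \<open>M\<close>, where \<open>n\<close> is unrelated to the actual sample size.\<close>

lemma integral_rank_density_le:
  assumes "s \<ge> 1"
  shows "(\<integral>y. rank_density s y * ((n choose s) * (1 - risk M g (g y)) ^ (n - s)) \<partial>M) \<le> 1"
proof -
  interpret P: prob_space "Pi\<^sub>M {1..n} (\<lambda>_::nat. M)" by (rule prob_space_samples)
  show ?thesis
    using prob_rank_value_in[of "{1..n}" s UNIV] assms P.prob_le_1[of "rank_value_in {1..n} s UNIV"]
    by (simp add: rank_density_def)
qed

subsection \<open>The confidence bound\<close>

lemma prob_rank_value_outside_le:
  assumes "1 \<le> s" "s \<le> N" "0 < \<beta>"
  shows "measure (Pi\<^sub>M {1..N} (\<lambda>_. M))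
    (rank_value_in {1..N} s {c. 1 - risk M g c \<notin> {t_low N \<beta> s..t_high N \<beta> s}}) \<le> \<beta>"
proof -
  let ?B = "{c. 1 - risk M g c \<notin> {t_low N \<beta> s..t_high N \<beta> s}}"
  let ?t = "\<lambda>y. 1 - risk M g (g y)" and ?w = "rank_density s"
  let ?h = "\<lambda>i y. ?w y * ((i choose s) * ?t y ^ (i - s))"
  have N: "N \<ge> 1" using assms by simp
  have B: "?B \<in> sets borel" by measurable
  have t: "0 \<le> ?t y" for y using risk_le_1 by simp
  have h: "0 \<le> ?h i y" for i y using t rank_density_nonneg by simp
  have h_int: "integrable M (?h i)" for i by (rule integrable_rank_density)
  have "measure (Pi\<^sub>M {1..N} (\<lambda>_. M)) (rank_value_in {1..N} s ?B) =
      (\<integral>y. indicator ?B (g y) * ?h N y \<partial>M)"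
    using prob_rank_value_in[OF _ assms(1) B, of "{1..N}"] by (simp add: rank_density_def)
  also have "\<dots> \<le> (\<integral>y. \<beta> / (2 * N) * (\<Sum>i=s..<N. ?h i y) + \<beta> / (6 * N) * (\<Sum>i=N+1..4*N. ?h i y) \<partial>M)"
  proof (rule integral_mono')
    show "integrable M (\<lambda>y. \<beta> / (2 * N) * (\<Sum>i=s..<N. ?h i y) + \<beta> / (6 * N) * (\<Sum>i=N+1..4*N. ?h i y))"
      by (intro Bochner_Integration.integrable_add integrable_mult_right
          Bochner_Integration.integrable_sum h_int)
    fix y
    show nonneg: "0 \<le> \<beta> / (2 * N) * (\<Sum>i=s..<N. ?h i y) + \<beta> / (6 * N) * (\<Sum>i=N+1..4*N. ?h i y)"
      using assms by (intro add_nonneg_nonneg mult_nonneg_nonneg sum_nonneg h) auto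
    show "indicator ?B (g y) * ?h N y \<le>
        \<beta> / (2 * N) * (\<Sum>i=s..<N. ?h i y) + \<beta> / (6 * N) * (\<Sum>i=N+1..4*N. ?h i y)"
    proof (cases "g y \<in> ?B")
      case True
      \<comment> \<open>Multiplying the polynomial inequality by \<open>w\<close> turns each
        monomial into the density for one sample size.\<close>
      then have "?w y * eps_poly N \<beta> s (?t y) \<le> 0"
        using eps_poly_nonpos_outside[OF assms(3) N assms(2) t] rank_density_nonneg
        by (intro mult_nonneg_nonpos) auto
      then show ?thesis
        using True by (simp add: eps_poly_def sum_distrib_left algebra_simps)
    next
      case False
      then show ?thesis using nonneg by (simp add: indicator_def)
    qed
  qed
  also have "\<dots> = \<beta> / (2 * N) * (\<Sum>i=s..<N. \<integral>y. ?h i y \<partial>M) + \<beta> / (6 * N) * (\<Sum>i=N+1..4*N. \<integral>y. ?h i y \<partial>M)"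
    using h_int by (subst Bochner_Integration.integral_add) (auto intro!: Bochner_Integration.integrable_sum)
  also have "\<dots> \<le> \<beta> / (2 * N) * (\<Sum>i=s..<N. 1) + \<beta> / (6 * N) * (\<Sum>i=N+1..4*N. 1)"
    using assms by (intro add_mono mult_left_mono sum_mono integral_rank_density_le) auto
  \<comment> \<open>There are \<open>N - s\<close> and \<open>3 * N\<close> summands, so each sum
    contributes at most \<open>\<beta> / 2\<close>.\<close>
  also have "\<dots> = \<beta> / (2 * N) * (N - s) + \<beta> / (6 * N) * (3 * N)"
    using assms(2) by simp
  also have "\<dots> \<le> \<beta> / (2 * N) * N + \<beta> / (6 * N) * (3 * N)"
    using assms by (intro add_mono mult_left_mono) auto
  also have "\<dots> = \<beta>" using N by simp
  finally show ?thesis .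
qed

section \<open>From order statistics to the optimal solution\<close>

lemma measurable_card_exceeding:
  assumes "e \<in> borel_measurable (Pi\<^sub>M {1..N} (\<lambda>_::nat. M))"
  shows "(\<lambda>x. card {i\<in>{1..N}. g (x i) > e x}) \<in> measurable (Pi\<^sub>M {1..N} (\<lambda>_::nat. M)) (count_space UNIV)"
proof (rule measurable_card)
  fix i
  show "{x\<in>space (Pi\<^sub>M {1..N} (\<lambda>_::nat. M)). i \<in> {i\<in>{1..N}. g (x i) > e x}} \<in> sets (Pi\<^sub>M {1..N} (\<lambda>_::nat. M))"
  proof (cases "i \<in> {1..N}")
    case True
    have "{x\<in>space (Pi\<^sub>M {1..N} (\<lambda>_::nat. M)). e x < g (x i)} \<in> sets (Pi\<^sub>M {1..N} (\<lambda>_::nat. M))"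
      by (rule borel_measurable_less[OF assms component_meas[OF True]])
    then show ?thesis using True by simp
  next
    case False
    then have "{x\<in>space (Pi\<^sub>M {1..N} (\<lambda>_::nat. M)). i \<in> {i\<in>{1..N}. g (x i) > e x}} = {}"
      by auto
    then show ?thesis by (simp only: sets.empty_sets)
  qed
qed

text \<open>The optimization problem enters only through \<open>e_le_iff\<close>. Almost every
  sample lies in the good event \<open>G\<close> or in the event \<open>U\<close> of probability at
  most \<beta>, so \<open>G\<close> has probability at least \<open>1 - \<beta>\<close>.\<close>

lemma scenario_bound:
  fixes e :: "(nat \<Rightarrow> 'a) \<Rightarrow> real" and N s :: nat
  defines "P \<equiv> Pi\<^sub>M {1..N} (\<lambda>_::nat. M)"
  assumes nonneg: "\<And>y. y \<in> space M \<Longrightarrow> 0 \<le> g y"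
    and N: "N \<ge> 1" and \<beta>: "0 < \<beta>" and s: "s \<ge> 1"
    and e_nonneg: "\<And>x. x \<in> space P \<Longrightarrow> 0 \<le> e x"
    and e_le_iff: "\<And>x c. x \<in> space P \<Longrightarrow> c \<ge> 0 \<Longrightarrow> e x \<le> c \<longleftrightarrow> card {i\<in>{1..N}. g (x i) > c} < s"
  shows "measure P {x\<in>space P.
      eps_low N \<beta> (1 + card {i\<in>{1..N}. g (x i) > e x}) \<le> risk M g (e x) \<and>
      risk M g (e x) \<le> eps_high N \<beta> (1 + card {i\<in>{1..N}. g (x i) > e x})} \<ge> 1 - \<beta>"
proof -
  interpret P: prob_space P unfolding P_def by (rule prob_space_samples)
  let ?r = "\<lambda>x. card {i\<in>{1..N}. g (x i) > e x}"
  let ?B = "{c. 1 - risk M g c \<notin> {t_low N \<beta> s..t_high N \<beta> s}}"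
  define G where "G = {x\<in>space P. eps_low N \<beta> (1 + ?r x) \<le> risk M g (e x) \<and> risk M g (e x) \<le> eps_high N \<beta> (1 + ?r x)}"
  define U where "U = (if s \<le> N then rank_value_in {1..N} s ?B else {})"
  \<comment> \<open>Measurability follows from \<open>e_le_iff\<close>: sublevel sets are counting
    events for \<open>c \<ge> 0\<close> and empty otherwise.\<close>
  have e_meas[measurable]: "e \<in> borel_measurable P"
  proof (rule borel_measurable_iff_le[THEN iffD2], rule allI)
    fix c
    show "{x\<in>space P. e x \<le> c} \<in> sets P"
    proof (cases "c \<ge> 0")
      case True
      have [measurable]: "(\<lambda>x. card {i\<in>{1..N}. g (x i) > c}) \<in> measurable P (count_space UNIV)"
        unfolding P_def by (rule measurable_card_exceeding) simp
      have "{x\<in>space P. card {i\<in>{1..N}. g (x i) > c} < s} \<in> sets P" by measurable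
      also have "{x\<in>space P. card {i\<in>{1..N}. g (x i) > c} < s} = {x\<in>space P. e x \<le> c}"
        using e_le_iff True by auto
      finally show ?thesis .
    next
      case False
      then have "{x\<in>space P. e x \<le> c} = {}" using e_nonneg by force
      then show ?thesis by (simp only: sets.empty_sets)
    qed
  qed
  have r_meas[measurable]: "?r \<in> measurable P (count_space UNIV)"
    using e_meas unfolding P_def by (rule measurable_card_exceeding)
  have [measurable]: "(\<lambda>x. eps_low N \<beta> (1 + ?r x)) \<in> borel_measurable P"
    "(\<lambda>x. eps_high N \<beta> (1 + ?r x)) \<in> borel_measurable P"
    by (rule measurable_compose[OF r_meas], simp)+
  have G: "G \<in> sets P" unfolding G_def by measurable
  have U: "U \<in> sets P"
  proof -
    have "?B \<in> sets borel" by measurable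
    then show ?thesis using sets_rank_cell[of "{1..N}" _ s ?B]
      by (auto simp: U_def P_def rank_value_in_def intro!: sets.finite_UN finite_rank_cells)
  qed
  have "AE x in P. x \<in> G \<union> U"
  proof -
    \<comment> \<open>For \<open>s > N\<close>, where \<open>e x = 0\<close>, this makes all
      \<open>N\<close> values exceed \<open>e x\<close>.\<close>
    have "AE y in M. g y \<noteq> 0"
      using no_atom[of 0] by (intro AE_I[where N = "{y\<in>space M. g y = 0}"]) (auto simp: emeasure_eq_measure)
    then have "AE x in P. g (x i) \<noteq> 0" if "i \<in> {1..N}" for i
      unfolding P_def using that by (intro AE_PiM_component prob_space_axioms)
    then have "AE x in P. \<forall>i\<in>{1..N}. g (x i) \<noteq> 0" by (intro AE_finite_allI) auto
    moreover have "AE x in P. inj_on (\<lambda>i. g (x i)) {1..N}" unfolding P_def by (rule AE_inj_on) simp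
    ultimately show ?thesis using AE_space
    proof eventually_elim
      fix x assume nz: "\<forall>i\<in>{1..N}. g (x i) \<noteq> 0" and inj: "inj_on (\<lambda>i. g (x i)) {1..N}" and x: "x \<in> space P"
      have g_nonneg: "g (x i) \<ge> 0" if "i \<in> {1..N}" for i
        using x that nonneg by (auto simp: P_def space_PiM PiE_iff)
      show "x \<in> G \<union> U"
      proof (cases "s \<le> N")
        case True
        then have "s - 1 < card {1..N}" using s by simp
        then obtain j where j: "j \<in> {1..N}" "card {i\<in>{1..N}. g (x i) > g (x j)} = s - 1"
          by (rule ex_rank[OF finite_atLeastAtMost inj])
        have "e x \<le> g (x j)" using e_le_iff[OF x g_nonneg[OF j(1)]] j(2) s by simp
        \<comment> \<open>Otherwise \<open>j\<close> joins the \<open>s - 1\<close> larger indices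
          and \<open>s\<close> values exceed \<open>e x\<close>, against \<open>e_le_iff\<close> at
          \<open>c = e x\<close>.\<close>
        moreover have "\<not> e x < g (x j)"
        proof
          assume less: "e x < g (x j)"
          have "card {i\<in>{1..N}. g (x i) > g (x j)} < card {i\<in>{1..N}. g (x i) > e x}"
          proof (rule psubset_card_mono)
            have "j \<in> {i\<in>{1..N}. g (x i) > e x} - {i\<in>{1..N}. g (x i) > g (x j)}" using j(1) less by simp
            then show "{i\<in>{1..N}. g (x i) > g (x j)} \<subset> {i\<in>{1..N}. g (x i) > e x}" using less by auto
          qed simp
          moreover have "card {i\<in>{1..N}. g (x i) > e x} < s" using e_le_iff[OF x e_nonneg[OF x]] by simp
          ultimately show False using j(2) by simp
        qed
        ultimately have e: "e x = g (x j)" by simp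
        then have r: "1 + ?r x = s" using j(2) s by simp
        show ?thesis
        proof (cases "g (x j) \<in> ?B")
          case True
          let ?A = "{i\<in>{1..N}. g (x i) > g (x j)}"
          have "x \<in> rank_event {1..N} j ?A"
          proof -
            have "g (x i) < g (x j)" if "i \<in> {1..N} - {j} - ?A" for i
              using that j(1) inj by (auto simp: not_less less_le dest: inj_onD)
            then show ?thesis using x by (auto simp: rank_event_def P_def)
          qed
          moreover have "(j, ?A) \<in> rank_cells {1..N} s" using j by (auto simp: rank_cells_def)
          ultimately have "x \<in> rank_value_in {1..N} s ?B" using True by (force simp: rank_value_in_def)
          then show ?thesis using \<open>s \<le> N\<close> by (simp add: U_def)
        next
          case False
          \<comment> \<open>Membership of \<open>1 - V\<close> in the interval gives both bounds;
            the truncation of \<open>eps_low\<close> at 0 is covered by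
            \<open>risk_ge_0\<close>.\<close>
          then have "x \<in> G"
            unfolding G_def r mem_Collect_eq using x e risk_ge_0 by (auto simp: eps_low_def eps_high_def)
          then show ?thesis by simp
        qed
      next
        \<comment> \<open>Here \<open>e x = 0\<close>, the risk is 1 and the complexity is
          \<open>N + 1\<close>. There \<open>t_low\<close> is 0 and \<open>t_high\<close> is
          nonnegative, so both bounds hold.\<close>
        case False
        have "card {i\<in>{1..N}. g (x i) > 0} < s"
          using False card_mono[of "{1..N}" "{i\<in>{1..N}. g (x i) > 0}"] by force
        then have e: "e x = 0" using e_le_iff[OF x order_refl] e_nonneg[OF x] by simp
        have "{i\<in>{1..N}. g (x i) > e x} = {1..N}" using nz g_nonneg by (auto simp: e less_le)
        then have r: "1 + ?r x = Suc N" by simp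
        have "{y\<in>space M. g y < 0} = {}" using nonneg by force
        then have "risk M g 0 = 1" using prob_less[of 0] by (simp only: measure_empty)
        then have "x \<in> G"
          unfolding G_def r mem_Collect_eq using x e t_high_N(1)[OF \<beta> N, of "Suc N"]
          by (simp add: eps_low_def eps_high_def t_low_def)
        then show ?thesis by simp
      qed
    qed
  qed
  then have "P.prob (G \<union> U) = 1" by (simp only: P.prob_eq_1[OF sets.Un[OF G U]])
  from this[symmetric] have "1 = P.prob (G \<union> U)" .
  also have "\<dots> \<le> P.prob G + P.prob U" using G U by (rule measure_Un_le)
  also have "\<dots> \<le> P.prob G + \<beta>"
    using prob_rank_value_outside_le[OF s _ \<beta>] \<beta> by (intro add_left_mono) (simp add: U_def P_def)
  finally have "1 - \<beta> \<le> P.prob G" by simp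
  then show ?thesis unfolding G_def .
qed

end

theorem theorem3:
  fixes \<Delta> :: "(real ^ 'd) set" and M :: "(real ^ 'd) measure"
    and z :: "nat \<Rightarrow> real ^ 'd \<Rightarrow> real ^ 'n" and \<phi> :: "real ^ 'n \<Rightarrow> real ^ 'd \<Rightarrow> real"
    and k N :: nat and \<rho> \<beta> :: real
    and sol :: "(nat \<Rightarrow> real ^ 'd) \<Rightarrow> real \<times> (nat \<Rightarrow> real)"
  assumes "prob_space M" and "space M = \<Delta>"
    and "performance \<phi> z k \<in> borel_measurable M"
    and "\<And>x. x \<in> \<Delta> \<Longrightarrow> performance \<phi> z k x \<ge> 0"
    and non_accumulation:
      "\<And>e. e \<ge> 0 \<Longrightarrow> measure M {x \<in> \<Delta>. performance \<phi> z k x = e} = 0"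
    and "\<rho> > 0" and "N \<ge> 1" and "0 < \<beta>" and "\<beta> < 1"
    and "tie_broken_solution \<rho> N (performance \<phi> z k) (space (Pi\<^sub>M {1..N} (\<lambda>_. M))) sol"
  shows "measure (Pi\<^sub>M {1..N} (\<lambda>_. M))
      {x \<in> space (Pi\<^sub>M {1..N} (\<lambda>_. M)).
         (let e = fst (sol x); s = 1 + num_relaxed N (snd (sol x))
          in eps_low N \<beta> s \<le> risk M (performance \<phi> z k) e \<and>
             risk M (performance \<phi> z k) e \<le> eps_high N \<beta> s)}
    \<ge> 1 - \<beta>"
proof -
  let ?g = "performance \<phi> z k" and ?P = "Pi\<^sub>M {1..N} (\<lambda>_. M)"
  interpret prob_space M by fact
  interpret continuous_rv M ?g
  proof
    show "measure M {x\<in>space M. ?g x = c} = 0" for c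
    \<comment> \<open>Negative levels are never attained, which extends non-accumulation to every
      real \<open>c\<close>.\<close>
    proof (cases "c \<ge> 0")
      case False
      then have "{x\<in>space M. ?g x = c} = {}" using assms(2,4) by force
      then show ?thesis by (simp only: measure_empty)
    qed (use non_accumulation assms(2) in simp)
  qed fact
  have opt: "relaxed_optimal \<rho> N (\<lambda>i. ?g (x i)) (fst (sol x)) (snd (sol x))" if "x \<in> space ?P" for x
    using assms(10) that by (simp add: tie_broken_solution_def comp_def)
  obtain s where s: "s \<ge> 1"
    "\<forall>x\<in>space ?P. \<forall>c\<ge>0. fst (sol x) \<le> c \<longleftrightarrow> card {i\<in>{1..N}. ?g (x i) > c} < s"
    using tie_broken_solution_le_iff[OF assms(6,10)] by blast
  have "1 - \<beta> \<le> measure ?P {x\<in>space ?P.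
      eps_low N \<beta> (1 + card {i\<in>{1..N}. ?g (x i) > fst (sol x)}) \<le> risk M ?g (fst (sol x)) \<and>
      risk M ?g (fst (sol x)) \<le> eps_high N \<beta> (1 + card {i\<in>{1..N}. ?g (x i) > fst (sol x)})}"
    using assms(2,4,6-8) s opt
    by (intro scenario_bound[where s = s]) (auto simp: relaxed_optimal_iff)
  then show ?thesis
    using num_relaxed_optimal[OF assms(6) opt] by (simp add: Let_def cong: conj_cong)
qed

end
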